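(* Let $\Omega\subset\mathbb{C}^n$, $n\ge 2$, be a domain and let $v\in C^2(\Omega)$. Then $v$ is $2$-harmonic if and only if $v$ is pluriharmonic.
   Context: Let $\omega=dd^c|z|^2$ be the standard Kähler form on $\mathbb{C}^n$, where $dd^c v=\frac{i}{2}\sum_{k,l}\frac{\partial^2 v}{\partial z_k\partial\bar z_l}\,dz_k\wedge d\bar z_l$. A real-valued function $v\in C^2(\Omega)$ is $m$-harmonic if $(dd^c v)^k\wedge\omega^{n-k}=0$ on $\Omega$ for every $k=1,2,\dots,m$; in particular $2$-harmonic means that this holds for $k=1$ and $k=2$. The function $v$ is pluriharmonic if $dd^c v=0$. *)

theory Defs
  imports "HOL-Analysis.Analysis"
begin

text \<open>The dimension n is \<open>CARD('n)\<close>.\<close>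

definition C2_on :: "('a::real_normed_vector \<Rightarrow> 'b::real_normed_vector) \<Rightarrow> 'a set \<Rightarrow> bool"
  where "C2_on f S \<longleftrightarrow>
    (\<exists>(f' :: 'a \<Rightarrow> 'a \<Rightarrow>\<^sub>L 'b) (f'' :: 'a \<Rightarrow> 'a \<Rightarrow>\<^sub>L 'a \<Rightarrow>\<^sub>L 'b).
      (\<forall>x\<in>S. (f has_derivative blinfun_apply (f' x)) (at x)) \<and>
      (\<forall>x\<in>S. (f' has_derivative blinfun_apply (f'' x)) (at x)) \<and>
      continuous_on S f'')"

definition dir_deriv :: "(complex^'n \<Rightarrow> complex) \<Rightarrow> complex^'n \<Rightarrow> complex^'n \<Rightarrow> complex"
  where "dir_deriv g e z = vector_derivative (\<lambda>t::real. g (z + t *\<^sub>R e)) (at 0)"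

definition wirtinger :: "'n \<Rightarrow> (complex^'n \<Rightarrow> complex) \<Rightarrow> complex^'n \<Rightarrow> complex"
  where "wirtinger k g z = (dir_deriv g (axis k 1) z - \<i> * dir_deriv g (axis k \<i>) z) / 2"

definition wirtinger_bar :: "'n \<Rightarrow> (complex^'n \<Rightarrow> complex) \<Rightarrow> complex^'n \<Rightarrow> complex"
  where "wirtinger_bar k g z = (dir_deriv g (axis k 1) z + \<i> * dir_deriv g (axis k \<i>) z) / 2"

text \<open>
  A complex-valued p-form at a point is its evaluation on tangent vectors: a function of a
  sequence of vectors that depends, alternatingly and real-multilinearly, on its first p entries.
  The degree is not recorded in the type, so the wedge product takes the two degrees as arguments.
\<close>

type_synonym 'n form = "(nat \<Rightarrow> complex^'n) \<Rightarrow> complex"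

definition wedge :: "nat \<Rightarrow> nat \<Rightarrow> 'n::finite form \<Rightarrow> 'n form \<Rightarrow> 'n form"
  where "wedge p q \<alpha> \<beta> w =
    (\<Sum>\<sigma> | \<sigma> permutes {..<p + q}.
      of_int (sign \<sigma>) * \<alpha> (\<lambda>i. w (\<sigma> i)) * \<beta> (\<lambda>i. w (\<sigma> (p + i)))) / (fact p * fact q)"

text \<open>Wedge powers of a 2-form; the k-th power has degree 2k.\<close>

primrec wedge_power :: "'n::finite form \<Rightarrow> nat \<Rightarrow> 'n form"
  where
    "wedge_power \<alpha> 0 = (\<lambda>w. 1)"
  | "wedge_power \<alpha> (Suc k) = wedge 2 (2 * k) \<alpha> (wedge_power \<alpha> k)"

definition dz :: "'n::finite \<Rightarrow> 'n form"
  where "dz k w = w 0 $ k"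

definition dzbar :: "'n::finite \<Rightarrow> 'n form"
  where "dzbar k w = cnj (w 0 $ k)"

definition ddc :: "(complex^'n \<Rightarrow> real) \<Rightarrow> complex^'n \<Rightarrow> 'n form"
  where "ddc v z w = \<i> / 2 *
    (\<Sum>k\<in>UNIV. \<Sum>l\<in>UNIV.
      wirtinger k (wirtinger_bar l (\<lambda>x. complex_of_real (v x))) z * wedge 1 1 (dz k) (dzbar l) w)"

definition kaehler_form :: "complex^'n \<Rightarrow> 'n form"
  where "kaehler_form = ddc (\<lambda>x. (norm x)\<^sup>2)"

text \<open>
  The difference of naturals is truncated, so \<open>m\<close> is meant to be at most \<open>CARD('n)\<close>. Differentiability
  of \<open>v\<close> is a separate hypothesis, \<open>C2_on v \<Omega>\<close>, for open \<open>\<Omega>\<close>.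
\<close>

definition m_harmonic_on :: "nat \<Rightarrow> (complex^'n \<Rightarrow> real) \<Rightarrow> (complex^'n) set \<Rightarrow> bool"
  where "m_harmonic_on m v \<Omega> \<longleftrightarrow>
    (\<forall>k\<in>{1..m}. \<forall>z\<in>\<Omega>. \<forall>w.
      wedge (2 * k) (2 * (CARD('n) - k))
        (wedge_power (ddc v z) k) (wedge_power (kaehler_form z) (CARD('n) - k)) w = 0)"

definition pluriharmonic_on :: "(complex^'n \<Rightarrow> real) \<Rightarrow> (complex^'n) set \<Rightarrow> bool"
  where "pluriharmonic_on v \<Omega> \<longleftrightarrow> (\<forall>z\<in>\<Omega>. \<forall>w. ddc v z w = 0)"

end

theory Submission
  imports Defs
begin

text \<open>
  At a point \<open>z\<close> let \<open>H\<close> be the complex Hessian of \<open>v\<close>, the matrix of the mixed Wirtinger derivatives.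
  It is Hermitian because second derivatives are symmetric (\<open>levi_hermitian\<close>). For a (1,1)-form
  \<open>\<alpha>\<close> with matrix \<open>H\<close> and the Kaehler form \<open>\<omega>\<close>, whose matrix is the identity, the products
  \<open>\<alpha> \<and> \<omega>\<^sup>n\<^sup>-\<^sup>1\<close> and \<open>\<alpha>\<^sup>2 \<and> \<omega>\<^sup>n\<^sup>-\<^sup>2\<close> are the volume form times \<open>tr H\<close> and times
  \<open>(tr H)\<^sup>2 - tr (H\<^sup>2)\<close>, up to nonzero constants. If both vanish, then
  \<open>tr (H\<^sup>2)\<close>, which is the sum of all \<open>\<bar>H k l\<bar>\<^sup>2\<close>, is zero, and so \<open>H = 0\<close> (\<open>hermitian_eq_0\<close>). The converse is clear, since a product with a zero factor
  vanishes.

  The work lies in evaluating the wedge products, which are sums over permutations. Wedge products of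
  alternations are alternations of tensor products (\<open>wedge_wedge_power_alternation\<close>), so both
  products are alternations of a product of \<open>n\<close> bilinear forms in the \<open>dz\<close> and \<open>dzbar\<close>. Expanding
  by multilinearity gives a sum over two index sequences \<open>\<kappa>\<close> and \<open>\<nu>\<close> of coefficients times
  monomials in the covectors. A monomial vanishes unless both sequences enumerate all coordinates,
  and since all but the first two matrices are the identity, \<open>\<nu>\<close> must be \<open>\<kappa>\<close> with its first two
  entries kept or exchanged (\<open>sum_monomial_forms_row\<close>). All remaining monomials are one and the
  same volume form up to sign, and it is nonzero (\<open>monomial_form_nonzero\<close>); the coefficients add up
  to a multiple of the sum of the two-by-two minors (\<open>mixed_discriminant\<close>).
\<close>

section \<open>Wedge products as alternations\<close>

definition alternation :: "nat \<Rightarrow> 'n::finite form \<Rightarrow> 'n form"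
  where "alternation N f w = (\<Sum>\<sigma> | \<sigma> permutes {..<N}. of_int (sign \<sigma>) * f (\<lambda>i. w (\<sigma> i)))"

lemma wedge_eq_alternation:
  "wedge p q \<alpha> \<beta> w = alternation (p + q) (\<lambda>u. \<alpha> u * \<beta> (\<lambda>i. u (p + i))) w / (fact p * fact q)"
  by (simp add: wedge_def alternation_def mult.assoc)

lemma alternation_sum:
  "alternation N (\<lambda>u. \<Sum>x\<in>X. c x * h x u) w = (\<Sum>x\<in>X. c x * alternation N (h x) w)"
  unfolding alternation_def sum_distrib_left
  by (subst sum.swap) (simp add: mult.left_commute)

lemma sign_mult_self: "of_int (sign \<sigma>) * of_int (sign \<sigma>) = (1 :: 'a::ring_1)"
  by (simp add: sign_def)

lemma alternation_permute:
  assumes "\<pi> permutes {..<N}"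
  shows "alternation N (\<lambda>u. h (\<lambda>i. u (\<pi> i))) w = of_int (sign \<pi>) * alternation N h w"
proof -
  have perm: "permutation \<pi>" using assms by (rule permutes_imp_permutation[rotated]) simp
  have "alternation N h w
      = (\<Sum>\<sigma> | \<sigma> permutes {..<N}. of_int (sign (\<sigma> \<circ> \<pi>)) * h (\<lambda>i. w ((\<sigma> \<circ> \<pi>) i)))"
    unfolding alternation_def by (rule sum_permutations_compose_right[OF assms])
  also have "\<dots> = (\<Sum>\<sigma> | \<sigma> permutes {..<N}. of_int (sign \<pi>) * (of_int (sign \<sigma>) * h (\<lambda>i. w (\<sigma> (\<pi> i)))))"
  proof (rule sum.cong, rule refl)
    fix \<sigma> assume "\<sigma> \<in> {\<sigma>. \<sigma> permutes {..<N}}"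
    then have "permutation \<sigma>" by (auto intro: permutes_imp_permutation)
    then have "sign (\<sigma> \<circ> \<pi>) = sign \<sigma> * sign \<pi>" using perm by (rule sign_compose)
    then show "of_int (sign (\<sigma> \<circ> \<pi>)) * h (\<lambda>i. w ((\<sigma> \<circ> \<pi>) i))
      = of_int (sign \<pi>) * (of_int (sign \<sigma>) * h (\<lambda>i. w (\<sigma> (\<pi> i))))"
      by (simp add: mult.commute mult.left_commute)
  qed
  also have "\<dots> = of_int (sign \<pi>) * alternation N (\<lambda>u. h (\<lambda>i. u (\<pi> i))) w"
    by (simp add: alternation_def sum_distrib_left)
  finally have "of_int (sign \<pi>) * alternation N h w
    = (of_int (sign \<pi>) * of_int (sign \<pi>)) * alternation N (\<lambda>u. h (\<lambda>i. u (\<pi> i))) w"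
    by (simp only: mult.assoc)
  then show ?thesis by (simp add: sign_mult_self)
qed

text \<open>
  A permutation of the first \<open>p\<close> slots is also a permutation of all of them, and alternating over
  everything undoes it at the cost of its sign. The two signs cancel, so each of the \<open>p!\<close>
  permutations in the inner alternation contributes the same amount. This is why the factorials in
  the definition of the wedge product disappear for alternated factors.
\<close>

lemma alternation_absorb_left:
  "alternation (p + q) (\<lambda>u. alternation p f u * g (\<lambda>i. u (p + i))) w
    = fact p * alternation (p + q) (\<lambda>u. f u * g (\<lambda>i. u (p + i))) w"
proof -
  define h where "h = (\<lambda>u. f u * g (\<lambda>i. u (p + i)))"
  have split: "alternation p f u * g (\<lambda>i. u (p + i))
      = (\<Sum>\<tau> | \<tau> permutes {..<p}. of_int (sign \<tau>) * h (\<lambda>i. u (\<tau> i)))" for u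
    unfolding alternation_def sum_distrib_right h_def
    by (intro sum.cong) (auto simp: mult.assoc permutes_not_in)
  have "alternation (p + q) (\<lambda>u. alternation p f u * g (\<lambda>i. u (p + i))) w
      = (\<Sum>\<tau> | \<tau> permutes {..<p}. of_int (sign \<tau>) * alternation (p + q) (\<lambda>u. h (\<lambda>i. u (\<tau> i))) w)"
    unfolding split by (rule alternation_sum)
  also have "\<dots> = (\<Sum>\<tau> | \<tau> permutes {..<p}. alternation (p + q) h w)"
  proof (rule sum.cong, rule refl)
    fix \<tau> assume "\<tau> \<in> {\<tau>. \<tau> permutes {..<p}}"
    then have "\<tau> permutes {..<p + q}" by (auto intro: permutes_subset)
    then show "of_int (sign \<tau>) * alternation (p + q) (\<lambda>u. h (\<lambda>i. u (\<tau> i))) w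
        = alternation (p + q) h w"
      by (simp add: alternation_permute mult.assoc[symmetric] sign_mult_self)
  qed
  also have "\<dots> = fact p * alternation (p + q) h w"
    by (simp add: card_permutations[of _ p])
  finally show ?thesis by (simp add: h_def)
qed

text \<open>
  The sign of the shifted permutation is not immediate from its pointwise description, so the
  permutation is built up from transpositions, whose shifts are again transpositions.
\<close>

lemma permutation_shift:
  fixes p q :: nat
  assumes "\<tau> permutes {..<q}"
  shows "\<exists>\<pi>. \<pi> permutes {..<p + q} \<and> sign \<pi> = sign \<tau> \<and> (\<forall>i<p. \<pi> i = i) \<and> (\<forall>i. \<pi> (p + i) = p + \<tau> i)"
  using assms finite_lessThan[of q]
proof (induction rule: permutes_induct)
  case id
  show ?case by (intro exI[of _ id]) (simp add: permutes_id[unfolded id_def] id_def)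
next
  case (swap a b \<tau>)
  then obtain \<pi> where \<pi>: "\<pi> permutes {..<p + q}" "sign \<pi> = sign \<tau>" "\<forall>i<p. \<pi> i = i"
    "\<forall>i. \<pi> (p + i) = p + \<tau> i" by blast
  let ?t = "Transposition.transpose (p + a) (p + b)"
  have t: "?t permutes {..<p + q}" using swap by (intro permutes_swap_id) auto
  have perms: "permutation \<tau>" "permutation \<pi>"
    using swap \<pi> by (auto intro: permutes_imp_permutation[OF finite_lessThan])
  have "(?t \<circ> \<pi>) permutes {..<p + q}" using \<pi>(1) t by (rule permutes_compose)
  moreover have "sign (?t \<circ> \<pi>) = sign (Transposition.transpose a b \<circ> \<tau>)"
    using perms \<pi>(2) swap(3) by (simp add: sign_compose permutation_swap_id sign_swap_id)
  moreover have "\<forall>i<p. (?t \<circ> \<pi>) i = i" using \<pi>(3) by (simp add: Transposition.transpose_def)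
  moreover have "\<forall>i. (?t \<circ> \<pi>) (p + i) = p + (Transposition.transpose a b \<circ> \<tau>) i"
    using \<pi>(4) by (auto simp: Transposition.transpose_def)
  ultimately show ?case by blast
qed

text \<open>
  The permutation of the last \<open>q\<close> slots is moved across the factor \<open>f\<close>, which is why \<open>f\<close> may only
  look at the first \<open>p\<close> slots.
\<close>

lemma alternation_absorb_right:
  assumes local: "\<And>u u'. (\<And>i. i < p \<Longrightarrow> u i = u' i) \<Longrightarrow> f u = f u'"
  shows "alternation (p + q) (\<lambda>u. f u * alternation q g (\<lambda>i. u (p + i))) w
    = fact q * alternation (p + q) (\<lambda>u. f u * g (\<lambda>i. u (p + i))) w"
proof -
  define h where "h = (\<lambda>u. f u * g (\<lambda>i. u (p + i)))"
  have split: "f u * alternation q g (\<lambda>i. u (p + i))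
      = (\<Sum>\<tau> | \<tau> permutes {..<q}. of_int (sign \<tau>) * (f u * g (\<lambda>i. u (p + \<tau> i))))" for u
    unfolding alternation_def sum_distrib_left
    by (intro sum.cong) (auto simp: mult.left_commute)
  have "alternation (p + q) (\<lambda>u. f u * alternation q g (\<lambda>i. u (p + i))) w
      = (\<Sum>\<tau> | \<tau> permutes {..<q}. of_int (sign \<tau>)
          * alternation (p + q) (\<lambda>u. f u * g (\<lambda>i. u (p + \<tau> i))) w)"
    unfolding split by (rule alternation_sum)
  also have "\<dots> = (\<Sum>\<tau> | \<tau> permutes {..<q}. alternation (p + q) h w)"
  proof (rule sum.cong, rule refl)
    fix \<tau> assume "\<tau> \<in> {\<tau>. \<tau> permutes {..<q}}"
    then obtain \<pi> where \<pi>: "\<pi> permutes {..<p + q}" "sign \<pi> = sign \<tau>" "\<forall>i<p. \<pi> i = i"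
      "\<forall>i. \<pi> (p + i) = p + \<tau> i" using permutation_shift by blast
    have "f (\<lambda>i. u (\<pi> i)) = f u" for u using \<pi>(3) by (intro local) simp
    then have "(\<lambda>u. f u * g (\<lambda>i. u (p + \<tau> i))) = (\<lambda>u. h (\<lambda>i. u (\<pi> i)))"
      using \<pi>(4) by (simp add: h_def)
    then show "of_int (sign \<tau>) * alternation (p + q) (\<lambda>u. f u * g (\<lambda>i. u (p + \<tau> i))) w
        = alternation (p + q) h w"
      using \<pi>(1,2) by (simp add: alternation_permute mult.assoc[symmetric] sign_mult_self)
  qed
  also have "\<dots> = fact q * alternation (p + q) h w"
    by (simp add: card_permutations[of _ q])
  finally show ?thesis by (simp add: h_def)
qed

lemma wedge_alternation:
  assumes "\<And>u u'. (\<And>i. i < p \<Longrightarrow> u i = u' i) \<Longrightarrow> f u = f u'"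
  shows "wedge p q (alternation p f) (alternation q g)
    = alternation (p + q) (\<lambda>u. f u * g (\<lambda>i. u (p + i)))"
proof
  fix w
  show "wedge p q (alternation p f) (alternation q g) w
    = alternation (p + q) (\<lambda>u. f u * g (\<lambda>i. u (p + i))) w"
    unfolding wedge_eq_alternation alternation_absorb_left
    by (simp add: alternation_absorb_right[OF assms])
qed

lemma wedge_power_alternation:
  "wedge_power (alternation 2 (\<lambda>u. b (u 0) (u 1))) m
    = alternation (2 * m) (\<lambda>u. \<Prod>i<m. b (u (2 * i)) (u (2 * i + 1)))"
proof (induction m)
  case 0
  have "{\<sigma>. \<sigma> permutes {..<0::nat}} = {id}" by auto
  then show ?case by (simp add: alternation_def fun_eq_iff)
next
  case (Suc m)
  show ?case
    unfolding wedge_power.simps Suc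
    by (subst wedge_alternation) (simp_all add: prod.lessThan_Suc_shift del: prod.lessThan_Suc)
qed

text \<open>
  With the absorption rules every product of wedge powers of two-forms becomes one alternation of a
  product of bilinear forms, without any numerical factor.
\<close>

lemma wedge_wedge_power_alternation:
  "wedge (2 * k) (2 * m)
      (wedge_power (alternation 2 (\<lambda>u. a (u 0) (u 1))) k)
      (wedge_power (alternation 2 (\<lambda>u. b (u 0) (u 1))) m)
    = alternation (2 * (k + m))
        (\<lambda>u. \<Prod>i<k + m. (if i < k then a else b) (u (2 * i)) (u (2 * i + 1)))"
proof -
  have "(\<Prod>i<k + m. (if i < k then a else b) (u (2 * i)) (u (2 * i + 1)))
      = (\<Prod>i<k. a (u (2 * i)) (u (2 * i + 1)))
        * (\<Prod>i<m. b (u (2 * k + 2 * i)) (u (2 * k + (2 * i + 1))))" for u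
    by (induction m) (simp_all add: algebra_simps)
  then show ?thesis
    unfolding wedge_power_alternation by (subst wedge_alternation) simp_all
qed

section \<open>Alternation of products of covectors\<close>

text \<open>
  Covectors that are orthogonal over a finite set of test vectors have a nonzero alternation. The
  alternation is paired, over all sequences of test vectors, with the conjugate of the product of the
  covectors. By orthogonality a permutation other than the identity contributes nothing and the
  identity contributes \<open>c ^ N\<close>, so the alternation cannot vanish on every such sequence.
\<close>

lemma alternation_covectors_nonzero:
  fixes e :: "'b \<Rightarrow> complex^'n::finite"
  assumes "finite J" and "c \<noteq> 0"
    and orth: "\<And>i j. i < N \<Longrightarrow> j < N \<Longrightarrow>
      (\<Sum>b\<in>J. \<phi> i (e b) * cnj (\<phi> j (e b))) = (if i = j then c else 0)"
  shows "\<exists>w. alternation N (\<lambda>u. \<Prod>j<N. \<phi> j (u j)) w \<noteq> 0"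
proof (rule ccontr)
  assume "\<not> ?thesis"
  then have zero: "alternation N (\<lambda>u. \<Prod>j<N. \<phi> j (u j)) w = 0" for w by blast
  define P where "P = PiE {..<N} (\<lambda>_. J)"
  have inner: "(\<Sum>g\<in>P. (\<Prod>j<N. \<phi> j (e (g (\<sigma> j)))) * cnj (\<Prod>j<N. \<phi> j (e (g j))))
      = (if \<sigma> = id then c ^ N else 0)" if \<sigma>: "\<sigma> permutes {..<N}" for \<sigma>
  proof -
    have inv: "inv \<sigma> permutes {..<N}" using \<sigma> by (rule permutes_inv)
    have "(\<Prod>j<N. \<phi> j (e (g (\<sigma> j)))) = (\<Prod>j<N. \<phi> (inv \<sigma> j) (e (g j)))" for g
      using prod.permute[OF inv, of "\<lambda>j. \<phi> j (e (g (\<sigma> j)))"]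
      by (simp add: o_def permutes_inverses[OF \<sigma>])
    then have "(\<Sum>g\<in>P. (\<Prod>j<N. \<phi> j (e (g (\<sigma> j)))) * cnj (\<Prod>j<N. \<phi> j (e (g j))))
        = (\<Sum>g\<in>P. \<Prod>j<N. \<phi> (inv \<sigma> j) (e (g j)) * cnj (\<phi> j (e (g j))))"
      by (simp add: prod.distrib)
    also have "\<dots> = (\<Prod>j<N. \<Sum>b\<in>J. \<phi> (inv \<sigma> j) (e b) * cnj (\<phi> j (e b)))"
      unfolding P_def using \<open>finite J\<close> by (intro prod_sum_PiE[symmetric]) auto
    also have "\<dots> = (\<Prod>j<N. if inv \<sigma> j = j then c else 0)"
      using permutes_in_image[OF inv] by (intro prod.cong) (auto simp: orth)
    also have "\<dots> = (if \<sigma> = id then c ^ N else 0)"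
    proof (cases "\<sigma> = id")
      case False
      then obtain j where "\<sigma> j \<noteq> j" by (auto simp: fun_eq_iff)
      then have "inv \<sigma> j \<noteq> j" "j < N"
        using permutes_inv_eq[OF \<sigma>] \<sigma> by (metis, metis lessThan_iff permutes_not_in)
      then show ?thesis using False by (auto intro!: prod_zero)
    qed (simp add: inv_id[unfolded id_def])
    finally show ?thesis .
  qed
  have "0 = (\<Sum>g\<in>P. alternation N (\<lambda>u. \<Prod>j<N. \<phi> j (u j)) (\<lambda>i. e (g i)) * cnj (\<Prod>j<N. \<phi> j (e (g j))))"
    by (simp add: zero)
  also have "\<dots> = (\<Sum>\<sigma> | \<sigma> permutes {..<N}. of_int (sign \<sigma>) *
      (\<Sum>g\<in>P. (\<Prod>j<N. \<phi> j (e (g (\<sigma> j)))) * cnj (\<Prod>j<N. \<phi> j (e (g j)))))"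
    unfolding alternation_def sum_distrib_left sum_distrib_right
    by (subst sum.swap) (simp add: mult.assoc)
  also have "\<dots> = (\<Sum>\<sigma> | \<sigma> permutes {..<N}. if \<sigma> = id then c ^ N else 0)"
  proof (rule sum.cong, rule refl)
    fix \<sigma> assume "\<sigma> \<in> {\<sigma>. \<sigma> permutes {..<N}}"
    then show "of_int (sign \<sigma>) *
        (\<Sum>g\<in>P. (\<Prod>j<N. \<phi> j (e (g (\<sigma> j)))) * cnj (\<Prod>j<N. \<phi> j (e (g j))))
      = (if \<sigma> = id then c ^ N else 0)"
      by (simp only: mem_Collect_eq inner) (simp add: sign_id)
  qed
  also have "\<dots> = c ^ N"
    by (simp add: sum.delta permutes_id finite_permutations)
  finally show False using \<open>c \<noteq> 0\<close> by simp
qed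

text \<open>
  The form \<open>i/2 \<Sum> H k l dz\<^sub>k \<otimes> dzbar\<^sub>l\<close> before antisymmetrization; its alternation is the
  (1,1)-form with coefficient matrix \<open>H\<close>.
\<close>

definition hform :: "('n::finite \<Rightarrow> 'n \<Rightarrow> complex) \<Rightarrow> complex^'n \<Rightarrow> complex^'n \<Rightarrow> complex"
  where "hform H x y = \<i> / 2 * (\<Sum>k\<in>UNIV. \<Sum>l\<in>UNIV. H k l * (x $ k * cnj (y $ l)))"

text \<open>
  This is \<open>dz\<close> with index \<open>\<kappa> 0\<close> wedge \<open>dzbar\<close> with index \<open>\<nu> 0\<close> wedge \<open>dz\<close> with index \<open>\<kappa> 1\<close>,
  and so on: holomorphic covectors sit in the even slots and antiholomorphic ones in the odd slots.
\<close>

definition monomial_form :: "nat \<Rightarrow> (nat \<Rightarrow> 'n) \<Rightarrow> (nat \<Rightarrow> 'n) \<Rightarrow> 'n::finite form"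
  where "monomial_form n \<kappa> \<nu> =
    alternation (2 * n) (\<lambda>u. \<Prod>i<n. u (2 * i) $ \<kappa> i * cnj (u (2 * i + 1) $ \<nu> i))"

lemma monomial_form_cong:
  assumes "\<And>i. i < n \<Longrightarrow> \<kappa> i = \<kappa>' i" "\<And>i. i < n \<Longrightarrow> \<nu> i = \<nu>' i"
  shows "monomial_form n \<kappa> \<nu> = monomial_form n \<kappa>' \<nu>'"
proof -
  have "(\<lambda>u. \<Prod>i<n. u (2 * i) $ \<kappa> i * cnj (u (2 * i + 1) $ \<nu> i))
    = (\<lambda>u. \<Prod>i<n. u (2 * i) $ \<kappa>' i * cnj (u (2 * i + 1) $ \<nu>' i))"
    using assms by (intro ext prod.cong) auto
  then show ?thesis by (simp add: monomial_form_def)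
qed

lemma monomial_form_swap_left:
  assumes "a < n" "b < n" "a \<noteq> b"
  shows "monomial_form n (\<kappa> \<circ> Transposition.transpose a b) \<nu> w = - monomial_form n \<kappa> \<nu> w"
proof -
  let ?t = "Transposition.transpose a b" and ?T = "Transposition.transpose (2 * a) (2 * b)"
  have t: "?t permutes {..<n}" and T: "?T permutes {..<2 * n}"
    using assms by (auto intro: permutes_swap_id)
  have "(\<Prod>i<n. u (2 * i) $ (\<kappa> \<circ> ?t) i) = (\<Prod>i<n. u (?T (2 * i)) $ \<kappa> i)" for u :: "nat \<Rightarrow> complex^'a"
    using prod.permute[OF t, of "\<lambda>i. u (?T (2 * i)) $ \<kappa> i"]
    by (simp add: o_def) (auto intro!: prod.cong simp: Transposition.transpose_def)
  note eq = this
  have T_fixes: "?T (2 * i + 1) = 2 * i + 1" for i by (simp add: Transposition.transpose_def) presburger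
  have "(\<lambda>u. \<Prod>i<n. u (2 * i) $ (\<kappa> \<circ> ?t) i * cnj (u (2 * i + 1) $ \<nu> i))
      = (\<lambda>u. (\<lambda>u. \<Prod>i<n. u (2 * i) $ \<kappa> i * cnj (u (2 * i + 1) $ \<nu> i)) (\<lambda>i. u (?T i)))"
    by (rule ext) (simp only: prod.distrib eq T_fixes)
  then show ?thesis
    unfolding monomial_form_def using alternation_permute[OF T] assms
    by (simp add: sign_swap_id)
qed

lemma monomial_form_swap_right:
  assumes "a < n" "b < n" "a \<noteq> b"
  shows "monomial_form n \<kappa> (\<nu> \<circ> Transposition.transpose a b) w = - monomial_form n \<kappa> \<nu> w"
proof -
  let ?t = "Transposition.transpose a b" and ?T = "Transposition.transpose (2 * a + 1) (2 * b + 1)"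
  have t: "?t permutes {..<n}" and T: "?T permutes {..<2 * n}"
    using assms by (auto intro: permutes_swap_id)
  have "(\<Prod>i<n. cnj (u (2 * i + 1) $ (\<nu> \<circ> ?t) i)) = (\<Prod>i<n. cnj (u (?T (2 * i + 1)) $ \<nu> i))" for u
    using prod.permute[OF t, of "\<lambda>i. cnj (u (?T (2 * i + 1)) $ \<nu> i)"]
    by (simp add: o_def) (auto intro!: prod.cong simp: Transposition.transpose_def)
  note eq = this
  have T_fixes: "?T (2 * i) = 2 * i" for i by (simp add: Transposition.transpose_def) presburger
  have "(\<lambda>u. \<Prod>i<n. u (2 * i) $ \<kappa> i * cnj (u (2 * i + 1) $ (\<nu> \<circ> ?t) i))
      = (\<lambda>u. (\<lambda>u. \<Prod>i<n. u (2 * i) $ \<kappa> i * cnj (u (2 * i + 1) $ \<nu> i)) (\<lambda>i. u (?T i)))"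
    by (rule ext) (simp only: prod.distrib eq T_fixes)
  then show ?thesis
    unfolding monomial_form_def using alternation_permute[OF T] assms
    by (simp add: sign_swap_id)
qed

text \<open>
  Swapping two equal indices changes nothing and yet reverses the sign.
\<close>

lemma monomial_form_eq_0:
  assumes "\<not> inj_on \<kappa> {..<n} \<or> \<not> inj_on \<nu> {..<n}"
  shows "monomial_form n \<kappa> \<nu> w = 0"
proof -
  have fixed: "\<mu> \<circ> Transposition.transpose a b = \<mu>" if "\<mu> a = \<mu> b" for a b and \<mu> :: "nat \<Rightarrow> 'a"
    using that by (auto simp: fun_eq_iff Transposition.transpose_def)
  from assms show ?thesis
  proof
    assume "\<not> inj_on \<kappa> {..<n}"
    then obtain a b where "a < n" "b < n" "a \<noteq> b" "\<kappa> a = \<kappa> b" by (auto simp: inj_on_def)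
    then show ?thesis using monomial_form_swap_left[of a n b \<kappa> \<nu> w] by (simp add: fixed)
  next
    assume "\<not> inj_on \<nu> {..<n}"
    then obtain a b where "a < n" "b < n" "a \<noteq> b" "\<nu> a = \<nu> b" by (auto simp: inj_on_def)
    then show ?thesis using monomial_form_swap_right[of a n b \<kappa> \<nu> w] by (simp add: fixed)
  qed
qed

text \<open>
  Each transposition is applied to both index sequences, so its two signs cancel.
\<close>

lemma monomial_form_permute:
  fixes n :: nat
  assumes "\<tau> permutes {..<n}"
  shows "monomial_form n (\<kappa> \<circ> \<tau>) (\<nu> \<circ> \<tau>) w = monomial_form n \<kappa> \<nu> w"
  using assms finite_lessThan[of n]
proof (induction arbitrary: \<kappa> \<nu> rule: permutes_induct)
  case (swap a b \<tau>)
  let ?t = "Transposition.transpose a b"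
  have "monomial_form n (\<kappa> \<circ> (?t \<circ> \<tau>)) (\<nu> \<circ> (?t \<circ> \<tau>)) w
      = monomial_form n ((\<kappa> \<circ> ?t) \<circ> \<tau>) ((\<nu> \<circ> ?t) \<circ> \<tau>) w"
    by (simp only: o_assoc)
  also have "\<dots> = monomial_form n (\<kappa> \<circ> ?t) (\<nu> \<circ> ?t) w" by (rule swap.IH)
  also have "\<dots> = monomial_form n \<kappa> \<nu> w"
    using swap.hyps by (simp add: monomial_form_swap_left monomial_form_swap_right)
  finally show ?case .
qed simp

text \<open>
  Any two enumerations of the coordinates differ by a permutation of positions, so there is just one
  volume form \<open>dz\<^sub>1 \<and> dzbar\<^sub>1 \<and> \<dots> \<and> dz\<^sub>n \<and> dzbar\<^sub>n\<close>.
\<close>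

lemma monomial_form_diagonal:
  fixes \<kappa> \<kappa>' :: "nat \<Rightarrow> 'n::finite"
  assumes "bij_betw \<kappa> {..<n} UNIV" "bij_betw \<kappa>' {..<n} UNIV"
  shows "monomial_form n \<kappa> \<kappa> w = monomial_form n \<kappa>' \<kappa>' w"
proof -
  define \<tau> where "\<tau> i = (if i < n then inv_into {..<n} \<kappa>' (\<kappa> i) else i)" for i
  have "bij_betw (inv_into {..<n} \<kappa>' \<circ> \<kappa>) {..<n} {..<n}"
    using assms(1) bij_betw_inv_into[OF assms(2)] by (rule bij_betw_trans)
  then have "bij_betw \<tau> {..<n} {..<n}"
    by (rule bij_betw_cong[THEN iffD1, rotated]) (simp add: \<tau>_def)
  then have \<tau>: "\<tau> permutes {..<n}" by (rule bij_imp_permutes) (simp add: \<tau>_def)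
  have "(\<kappa>' \<circ> \<tau>) i = \<kappa> i" if "i < n" for i
    using that assms(2) by (simp add: \<tau>_def f_inv_into_f bij_betw_def)
  then have "monomial_form n \<kappa> \<kappa> = monomial_form n (\<kappa>' \<circ> \<tau>) (\<kappa>' \<circ> \<tau>)"
    by (intro monomial_form_cong) auto
  then show ?thesis by (simp add: monomial_form_permute[OF \<tau>])
qed

text \<open>
  The \<open>dz\<close> and \<open>dzbar\<close> are orthogonal over the real basis of vectors \<open>e\<close> and \<open>\<i> e\<close>: distinct
  coordinates have disjoint supports, and for \<open>dz\<close> against \<open>dzbar\<close> of one coordinate the two
  contributions are \<open>1\<close> and \<open>\<i> * \<i> = -1\<close>.
\<close>

lemma monomial_form_nonzero:
  fixes \<kappa> :: "nat \<Rightarrow> 'n::finite"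
  assumes "inj_on \<kappa> {..<n}"
  shows "\<exists>w. monomial_form n \<kappa> \<kappa> w \<noteq> 0"
proof -
  define \<phi> where "\<phi> j x = (if even j then x $ \<kappa> (j div 2) else cnj (x $ \<kappa> (j div 2)))"
    for j and x :: "complex^'n"
  have pairs: "(\<Prod>j<2 * n. F j) = (\<Prod>i<n. F (2 * i) * F (2 * i + 1))" for F :: "nat \<Rightarrow> complex"
    by (induction n) (simp_all add: mult.assoc)
  let ?J = "(UNIV :: 'n set) \<times> {1, \<i>}"
  have "(\<Sum>b\<in>?J. \<phi> i (axis (fst b) (snd b)) * cnj (\<phi> j (axis (fst b) (snd b)))) = (if i = j then 2 else 0)"
    if ij: "i < 2 * n" "j < 2 * n" for i j
  proof -
    have eq: "\<kappa> (i div 2) = \<kappa> (j div 2) \<longleftrightarrow> i div 2 = j div 2"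
      using assms ij by (auto simp: inj_on_def)
    have "(\<Sum>b\<in>?J. \<phi> i (axis (fst b) (snd b)) * cnj (\<phi> j (axis (fst b) (snd b))))
        = (\<Sum>k\<in>UNIV. \<phi> i (axis k 1) * cnj (\<phi> j (axis k 1)) + \<phi> i (axis k \<i>) * cnj (\<phi> j (axis k \<i>)))"
      using complex_i_not_one by (subst sum.cartesian_product') (auto intro!: sum.cong)
    also have "\<dots> = (\<Sum>k\<in>UNIV. if k = \<kappa> (i div 2) then (if i = j then 2 else 0) else 0)"
    proof (rule sum.cong, rule refl)
      fix k
      have "i = j \<longleftrightarrow> i div 2 = j div 2 \<and> (even i \<longleftrightarrow> even j)" by presburger
      then show "\<phi> i (axis k 1) * cnj (\<phi> j (axis k 1)) + \<phi> i (axis k \<i>) * cnj (\<phi> j (axis k \<i>))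
          = (if k = \<kappa> (i div 2) then (if i = j then 2 else 0) else 0)"
        using eq by (auto simp: \<phi>_def axis_def)
    qed
    also have "\<dots> = (if i = j then 2 else 0)" by simp
    finally show ?thesis .
  qed
  from alternation_covectors_nonzero[of ?J 2, OF _ _ this]
  obtain w where "alternation (2 * n) (\<lambda>u. \<Prod>j<2 * n. \<phi> j (u j)) w \<noteq> 0" by auto
  then show ?thesis by (auto simp: monomial_form_def pairs \<phi>_def)
qed

lemma alternation_hform_expand:
  fixes M :: "nat \<Rightarrow> 'n::finite \<Rightarrow> 'n \<Rightarrow> complex"
  shows "alternation (2 * n) (\<lambda>u. \<Prod>i<n. hform (M i) (u (2 * i)) (u (2 * i + 1))) w
    = (\<i> / 2) ^ n * (\<Sum>\<kappa>\<in>PiE {..<n} (\<lambda>_. UNIV). \<Sum>\<nu>\<in>PiE {..<n} (\<lambda>_. UNIV).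
        (\<Prod>i<n. M i (\<kappa> i) (\<nu> i)) * monomial_form n \<kappa> \<nu> w)"
proof -
  let ?P = "PiE {..<n} (\<lambda>_. UNIV :: 'n set)"
  have "(\<Prod>i<n. hform (M i) (u (2 * i)) (u (2 * i + 1)))
      = (\<Sum>(\<kappa>, \<nu>)\<in>?P \<times> ?P. ((\<i> / 2) ^ n * (\<Prod>i<n. M i (\<kappa> i) (\<nu> i)))
          * (\<Prod>i<n. u (2 * i) $ \<kappa> i * cnj (u (2 * i + 1) $ \<nu> i)))" for u :: "nat \<Rightarrow> complex^'n"
  proof -
    have "(\<Prod>i<n. hform (M i) (u (2 * i)) (u (2 * i + 1)))
        = (\<Prod>i<n. \<Sum>k\<in>UNIV. \<Sum>l\<in>UNIV.
            (\<i> / 2 * M i k l) * (u (2 * i) $ k * cnj (u (2 * i + 1) $ l)))"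
      by (simp only: hform_def sum_distrib_left mult.assoc)
    also have "\<dots> = (\<Sum>\<kappa>\<in>?P. \<Prod>i<n. \<Sum>l\<in>UNIV.
            (\<i> / 2 * M i (\<kappa> i) l) * (u (2 * i) $ \<kappa> i * cnj (u (2 * i + 1) $ l)))"
      by (rule prod_sum_PiE) auto
    also have "\<dots> = (\<Sum>\<kappa>\<in>?P. \<Sum>\<nu>\<in>?P. \<Prod>i<n.
            (\<i> / 2 * M i (\<kappa> i) (\<nu> i)) * (u (2 * i) $ \<kappa> i * cnj (u (2 * i + 1) $ \<nu> i)))"
      by (intro sum.cong refl prod_sum_PiE) auto
    also have "\<dots> = (\<Sum>(\<kappa>, \<nu>)\<in>?P \<times> ?P. \<Prod>i<n.
            (\<i> / 2 * M i (\<kappa> i) (\<nu> i)) * (u (2 * i) $ \<kappa> i * cnj (u (2 * i + 1) $ \<nu> i)))"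
      by (rule sum.cartesian_product)
    finally show ?thesis by (simp only: prod.distrib prod_constant card_lessThan)
  qed
  then have "alternation (2 * n) (\<lambda>u. \<Prod>i<n. hform (M i) (u (2 * i)) (u (2 * i + 1))) w
      = (\<Sum>(\<kappa>, \<nu>)\<in>?P \<times> ?P. ((\<i> / 2) ^ n * (\<Prod>i<n. M i (\<kappa> i) (\<nu> i))) * monomial_form n \<kappa> \<nu> w)"
    unfolding monomial_form_def by (simp only: case_prod_unfold) (rule alternation_sum)
  then show ?thesis
    by (simp add: sum.cartesian_product[symmetric] sum_distrib_left mult.assoc)
qed

text \<open>
  Every ordered pair of distinct values is taken at the positions 0 and 1 by the same number of
  enumerations, because a permutation of the values carries one pair to any other.
\<close>

lemma sum_over_injections:
  assumes "CARD('n::finite) \<ge> 2" and n: "n = CARD('n)"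
  shows "\<exists>c>0. \<forall>f :: 'n \<Rightarrow> 'n \<Rightarrow> complex.
    (\<Sum>\<kappa> | \<kappa> \<in> PiE {..<n} (\<lambda>_. UNIV) \<and> inj_on \<kappa> {..<n}. f (\<kappa> 0) (\<kappa> 1))
      = of_nat c * (\<Sum>(a, b) | a \<noteq> b. f a b)"
proof -
  define S where "S = {\<kappa> \<in> PiE {..<n} (\<lambda>_. UNIV :: 'n set). inj_on \<kappa> {..<n}}"
  define R where "R a b = {\<kappa> \<in> S. (\<kappa> 0, \<kappa> 1) = (a, b)}" for a b
  have fin: "finite S" unfolding S_def by (simp add: finite_PiE)
  have n2: "0 < n" "1 < n" using assms by auto
  have le: "card (R a b) \<le> card (R a' b')" if "a \<noteq> b" "a' \<noteq> b'" for a b a' b'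
  proof -
    \<comment> \<open>The inner transposition sends \<open>a\<close> to \<open>a'\<close>; the outer one repairs the image of \<open>b\<close> and fixes \<open>a'\<close>.\<close>
    define \<pi> where "\<pi> = Transposition.transpose (Transposition.transpose a a' b) b' \<circ> Transposition.transpose a a'"
    have \<pi>: "inj \<pi>" unfolding \<pi>_def by (intro inj_compose inj_transpose)
    have \<pi>_ab: "\<pi> a = a'" "\<pi> b = b'"
      using that by (auto simp: \<pi>_def Transposition.transpose_def)
    show ?thesis
    proof (rule card_inj_on_le)
      show "inj_on (\<lambda>\<kappa>. restrict (\<pi> \<circ> \<kappa>) {..<n}) (R a b)"
      proof (rule inj_onI)
        fix \<kappa> \<mu> assume *: "\<kappa> \<in> R a b" "\<mu> \<in> R a b"
          "restrict (\<pi> \<circ> \<kappa>) {..<n} = restrict (\<pi> \<circ> \<mu>) {..<n}"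
        show "\<kappa> = \<mu>"
        proof (rule PiE_ext)
          show "\<kappa> \<in> PiE {..<n} (\<lambda>_. UNIV)" "\<mu> \<in> PiE {..<n} (\<lambda>_. UNIV)"
            using * by (auto simp: R_def S_def)
          fix i assume "i \<in> {..<n}"
          then have "\<pi> (\<kappa> i) = \<pi> (\<mu> i)" using fun_cong[OF *(3), of i] by simp
          then show "\<kappa> i = \<mu> i" using \<pi> by (simp add: inj_eq)
        qed
      qed
      show "(\<lambda>\<kappa>. restrict (\<pi> \<circ> \<kappa>) {..<n}) ` R a b \<subseteq> R a' b'"
      proof (rule image_subsetI)
        fix \<kappa> assume "\<kappa> \<in> R a b"
        then have \<kappa>: "inj_on \<kappa> {..<n}" "\<kappa> 0 = a" "\<kappa> 1 = b" by (auto simp: R_def S_def)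
        have "inj_on (restrict (\<pi> \<circ> \<kappa>) {..<n}) {..<n}"
          using comp_inj_on[OF \<kappa>(1) inj_on_subset[OF \<pi> subset_UNIV]]
          by (simp only: inj_on_restrict_eq)
        then show "restrict (\<pi> \<circ> \<kappa>) {..<n} \<in> R a' b'"
          using \<kappa>(2,3) \<pi>_ab n2 by (simp add: R_def S_def)
      qed
      show "finite (R a' b')" using fin by (simp add: R_def)
    qed
  qed
  obtain \<kappa> :: "nat \<Rightarrow> 'n" where "bij_betw \<kappa> {0..<n} UNIV"
    using ex_bij_betw_nat_finite[of "UNIV :: 'n set"] n by auto
  then have \<kappa>: "inj_on \<kappa> {..<n}" by (simp add: bij_betw_def atLeast0LessThan)
  define a0 b0 where "a0 = \<kappa> 0" and "b0 = \<kappa> 1"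
  have "a0 \<noteq> b0" using inj_onD[OF \<kappa>, of 0 1] n2 by (auto simp: a0_def b0_def)
  have "restrict \<kappa> {..<n} \<in> R a0 b0"
    using \<kappa> n2 by (simp add: R_def S_def a0_def b0_def)
  moreover have "finite (R a0 b0)" using fin by (simp add: R_def)
  ultimately have "card (R a0 b0) > 0" by (auto simp only: card_gt_0_iff)
  moreover have "(\<Sum>\<kappa>\<in>S. f (\<kappa> 0) (\<kappa> 1)) = of_nat (card (R a0 b0)) * (\<Sum>(a, b) | a \<noteq> b. f a b)"
    for f :: "'n \<Rightarrow> 'n \<Rightarrow> complex"
  proof -
    have "(\<kappa> 0, \<kappa> 1) \<in> {(a, b). a \<noteq> b}" if "\<kappa> \<in> S" for \<kappa>
      using that n2 inj_onD[of \<kappa> "{..<n}" 0 1] by (auto simp: S_def)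
    then have "(\<Sum>\<kappa>\<in>S. f (\<kappa> 0) (\<kappa> 1))
        = (\<Sum>p\<in>{(a, b). a \<noteq> b}. \<Sum>\<kappa> | \<kappa> \<in> S \<and> (\<kappa> 0, \<kappa> 1) = p. f (\<kappa> 0) (\<kappa> 1))"
      using fin by (intro sum.group[symmetric]) auto
    also have "\<dots> = (\<Sum>p\<in>{(a, b). a \<noteq> b}. of_nat (card (R a0 b0)) * (case p of (a, b) \<Rightarrow> f a b))"
    proof (rule sum.cong, rule refl)
      fix p :: "'n \<times> 'n" assume "p \<in> {(a, b). a \<noteq> b}"
      then obtain a b where p: "p = (a, b)" "a \<noteq> b" by auto
      have "(\<Sum>\<kappa> | \<kappa> \<in> S \<and> (\<kappa> 0, \<kappa> 1) = p. f (\<kappa> 0) (\<kappa> 1)) = (\<Sum>\<kappa>\<in>R a b. f a b)"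
        unfolding R_def p by (intro sum.cong) auto
      also have "\<dots> = of_nat (card (R a b)) * f a b" by simp
      also have "card (R a b) = card (R a0 b0)"
        using le p \<open>a0 \<noteq> b0\<close> by (intro order_antisym) auto
      finally show "(\<Sum>\<kappa> | \<kappa> \<in> S \<and> (\<kappa> 0, \<kappa> 1) = p. f (\<kappa> 0) (\<kappa> 1))
        = of_nat (card (R a0 b0)) * (case p of (a, b) \<Rightarrow> f a b)" by (simp add: p)
    qed
    finally show ?thesis by (simp add: sum_distrib_left)
  qed
  ultimately show ?thesis unfolding S_def by (intro exI[of _ "card (R a0 b0)"] conjI allI)
qed

text \<open>
  From position 2 on the coefficient matrix is the identity, so a contributing \<open>\<nu>\<close> agrees with \<open>\<kappa>\<close>
  there. Being injective, it can then only keep or exchange the two values at the positions 0 and 1,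
  and the exchange costs a sign: this is the origin of the two-by-two minors.
\<close>

lemma sum_monomial_forms_row:
  fixes \<kappa> :: "nat \<Rightarrow> 'n::finite"
  assumes n: "n = CARD('n)" "n \<ge> 2"
    and \<kappa>: "\<kappa> \<in> PiE {..<n} (\<lambda>_. UNIV)" "inj_on \<kappa> {..<n}"
    and M: "\<And>i. i \<ge> 2 \<Longrightarrow> M i = (\<lambda>k l. if k = l then 1 else 0)"
  shows "(\<Sum>\<nu>\<in>PiE {..<n} (\<lambda>_. UNIV). (\<Prod>i<n. M i (\<kappa> i) (\<nu> i)) * monomial_form n \<kappa> \<nu> w)
    = (M 0 (\<kappa> 0) (\<kappa> 0) * M 1 (\<kappa> 1) (\<kappa> 1) - M 0 (\<kappa> 0) (\<kappa> 1) * M 1 (\<kappa> 1) (\<kappa> 0))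
        * monomial_form n \<kappa> \<kappa> w"
proof -
  let ?P = "PiE {..<n} (\<lambda>_. UNIV :: 'n set)" and ?t = "Transposition.transpose 0 (1 :: nat)"
  let ?F = "\<lambda>\<nu>. (\<Prod>i<n. M i (\<kappa> i) (\<nu> i)) * monomial_form n \<kappa> \<nu> w"
  have n2: "0 < n" "1 < n" using n by auto
  have split: "(\<Prod>i<n. g i) = g 0 * g 1 * (\<Prod>i=2..<n. g i)" for g :: "nat \<Rightarrow> complex"
  proof -
    have "{..<n} = insert 0 (insert 1 {2..<n})" using n2 by auto
    then show ?thesis by (simp add: mult.assoc)
  qed
  have surj: "\<kappa> ` {..<n} = UNIV"
    using \<kappa>(2) n(1) by (intro card_subset_eq) (auto simp: card_image)
  have "?t permutes {..<n}" using n2 by (intro permutes_swap_id) auto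
  then have tP: "\<kappa> \<circ> ?t \<in> ?P"
    using \<kappa>(1) n2 by (auto simp: PiE_iff extensional_def Transposition.transpose_def)
  have neq: "\<kappa> 0 \<noteq> \<kappa> 1" using inj_onD[OF \<kappa>(2), of 0 1] n2 by auto
  have "\<nu> = \<kappa> \<or> \<nu> = \<kappa> \<circ> ?t" if \<nu>: "\<nu> \<in> ?P" "?F \<nu> \<noteq> 0" for \<nu>
  proof -
    have inj: "inj_on \<nu> {..<n}" using \<nu>(2) monomial_form_eq_0[of \<kappa> n \<nu> w] by auto
    have "M i (\<kappa> i) (\<nu> i) \<noteq> 0" if "i < n" for i
      using \<nu>(2) that by auto
    then have tail: "\<nu> i = \<kappa> i" if "2 \<le> i" "i < n" for i
      using M[OF that(1)] that(2) by (metis (full_types))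
    have head: "\<nu> i = \<kappa> 0 \<or> \<nu> i = \<kappa> 1" if "i < 2" for i
    proof -
      obtain j where j: "j < n" "\<nu> i = \<kappa> j" using surj by (metis UNIV_I imageE lessThan_iff)
      have "\<not> 2 \<le> j"
      proof
        assume "2 \<le> j"
        then have "\<nu> i = \<nu> j" using tail j by simp
        then show False using inj_onD[OF inj, of i j] \<open>2 \<le> j\<close> that j n2 by auto
      qed
      then have "j = 0 \<or> j = 1" by auto
      then show ?thesis using j by auto
    qed
    have "\<nu> 0 \<noteq> \<nu> 1" using inj_onD[OF inj, of 0 1] n2 by auto
    then consider "\<nu> 0 = \<kappa> 0" "\<nu> 1 = \<kappa> 1" | "\<nu> 0 = \<kappa> 1" "\<nu> 1 = \<kappa> 0"
      using head[of 0] head[of 1] by force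
    then show ?thesis
    proof cases
      case 1
      have "\<nu> i = \<kappa> i" if "i < n" for i
        using 1 tail[OF _ that] by (cases "2 \<le> i") (auto simp: not_le less_2_cases_iff)
      then show ?thesis using PiE_ext[OF \<nu>(1) \<kappa>(1)] by auto
    next
      case 2
      have "\<nu> i = (\<kappa> \<circ> ?t) i" if "i < n" for i
        using 2 tail[OF _ that] by (cases "2 \<le> i") (auto simp: not_le less_2_cases_iff Transposition.transpose_def)
      then show ?thesis using PiE_ext[OF \<nu>(1) tP] by auto
    qed
  qed
  then have "\<forall>\<nu>\<in>?P - {\<kappa>, \<kappa> \<circ> ?t}. ?F \<nu> = 0" by blast
  then have "(\<Sum>\<nu>\<in>?P. ?F \<nu>) = (\<Sum>\<nu>\<in>{\<kappa>, \<kappa> \<circ> ?t}. ?F \<nu>)"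
    using \<kappa>(1) tP by (intro sum.mono_neutral_right) (simp_all add: finite_PiE)
  also have "\<dots> = ?F \<kappa> + ?F (\<kappa> \<circ> ?t)"
  proof -
    have "\<kappa> \<noteq> \<kappa> \<circ> ?t" using neq by (metis comp_apply transpose_apply_first)
    then show ?thesis by simp
  qed
  also have "?F \<kappa> = M 0 (\<kappa> 0) (\<kappa> 0) * M 1 (\<kappa> 1) (\<kappa> 1) * monomial_form n \<kappa> \<kappa> w"
    unfolding split by (simp add: M)
  also have "?F (\<kappa> \<circ> ?t) = - (M 0 (\<kappa> 0) (\<kappa> 1) * M 1 (\<kappa> 1) (\<kappa> 0) * monomial_form n \<kappa> \<kappa> w)"
    unfolding split using n2 by (simp add: M monomial_form_swap_right)
  finally show ?thesis by (simp add: algebra_simps)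
qed

text \<open>
  The coefficient of the volume form in a wedge product of two (1,1)-forms and \<open>n - 2\<close> copies of the
  standard Kaehler form is, up to a nonzero constant, the polarized sum of the principal two-by-two
  minors. The pairs with \<open>a = b\<close> contribute zero, so the double sum runs over all pairs. The constant
  and the test vectors do not depend on the matrices, which lets one choice serve both wedge
  products of the theorem.
\<close>

lemma mixed_discriminant:
  assumes n: "n = CARD('n::finite)" "n \<ge> 2"
  shows "\<exists>C w. C \<noteq> 0 \<and> (\<forall>M :: nat \<Rightarrow> 'n \<Rightarrow> 'n \<Rightarrow> complex.
    (\<forall>i\<ge>2. M i = (\<lambda>k l. if k = l then 1 else 0)) \<longrightarrow>
    alternation (2 * n) (\<lambda>u. \<Prod>i<n. hform (M i) (u (2 * i)) (u (2 * i + 1))) w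
      = C * (\<Sum>a\<in>UNIV. \<Sum>b\<in>UNIV. M 0 a a * M 1 b b - M 0 a b * M 1 b a))"
proof -
  let ?P = "PiE {..<n} (\<lambda>_. UNIV :: 'n set)"
  obtain c where c: "c > 0" and count: "\<And>f :: 'n \<Rightarrow> 'n \<Rightarrow> complex.
    (\<Sum>\<kappa> | \<kappa> \<in> ?P \<and> inj_on \<kappa> {..<n}. f (\<kappa> 0) (\<kappa> 1)) = of_nat c * (\<Sum>(a, b) | a \<noteq> b. f a b)"
    using sum_over_injections n by blast
  obtain \<mu> :: "nat \<Rightarrow> 'n" where "bij_betw \<mu> {0..<n} UNIV"
    using ex_bij_betw_nat_finite[of "UNIV :: 'n set"] n by auto
  then have \<mu>: "bij_betw \<mu> {..<n} UNIV" by (simp add: atLeast0LessThan)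
  then obtain w where w: "monomial_form n \<mu> \<mu> w \<noteq> 0"
    using monomial_form_nonzero bij_betw_imp_inj_on by blast
  let ?C = "(\<i> / 2) ^ n * (of_nat c * monomial_form n \<mu> \<mu> w)"
  have "alternation (2 * n) (\<lambda>u. \<Prod>i<n. hform (M i) (u (2 * i)) (u (2 * i + 1))) w
      = ?C * (\<Sum>a\<in>UNIV. \<Sum>b\<in>UNIV. M 0 a a * M 1 b b - M 0 a b * M 1 b a)"
    if M: "\<forall>i\<ge>2. M i = (\<lambda>k l. if k = l then 1 else 0)" for M :: "nat \<Rightarrow> 'n \<Rightarrow> 'n \<Rightarrow> complex"
  proof -
    let ?f = "\<lambda>a b. M 0 a a * M 1 b b - M 0 a b * M 1 b a"
    have "(\<Sum>\<kappa>\<in>?P. \<Sum>\<nu>\<in>?P. (\<Prod>i<n. M i (\<kappa> i) (\<nu> i)) * monomial_form n \<kappa> \<nu> w)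
        = (\<Sum>\<kappa> | \<kappa> \<in> ?P \<and> inj_on \<kappa> {..<n}. \<Sum>\<nu>\<in>?P. (\<Prod>i<n. M i (\<kappa> i) (\<nu> i)) * monomial_form n \<kappa> \<nu> w)"
      by (intro sum.mono_neutral_right) (auto simp: finite_PiE monomial_form_eq_0)
    also have "\<dots> = (\<Sum>\<kappa> | \<kappa> \<in> ?P \<and> inj_on \<kappa> {..<n}. ?f (\<kappa> 0) (\<kappa> 1) * monomial_form n \<mu> \<mu> w)"
    proof (rule sum.cong, rule refl)
      fix \<kappa> assume "\<kappa> \<in> {\<kappa> \<in> ?P. inj_on \<kappa> {..<n}}"
      then have \<kappa>: "\<kappa> \<in> ?P" "inj_on \<kappa> {..<n}" by auto
      have "\<kappa> ` {..<n} = UNIV"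
        using \<kappa>(2) n(1) by (intro card_subset_eq) (auto simp: card_image)
      then have "bij_betw \<kappa> {..<n} UNIV" using \<kappa>(2) by (simp add: bij_betw_def)
      then have "monomial_form n \<kappa> \<kappa> w = monomial_form n \<mu> \<mu> w"
        using \<mu> by (rule monomial_form_diagonal)
      then show "(\<Sum>\<nu>\<in>?P. (\<Prod>i<n. M i (\<kappa> i) (\<nu> i)) * monomial_form n \<kappa> \<nu> w)
          = ?f (\<kappa> 0) (\<kappa> 1) * monomial_form n \<mu> \<mu> w"
        using sum_monomial_forms_row[OF n \<kappa>, of M w] M by simp
    qed
    also have "\<dots> = of_nat c * (\<Sum>(a, b) | a \<noteq> b. ?f a b) * monomial_form n \<mu> \<mu> w"
      using count[of ?f] by (simp only: sum_distrib_right[symmetric])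
    also have "(\<Sum>(a, b) | a \<noteq> b. ?f a b) = (\<Sum>(a, b)\<in>UNIV \<times> UNIV. ?f a b)"
      by (intro sum.mono_neutral_left) auto
    also have "\<dots> = (\<Sum>a\<in>UNIV. \<Sum>b\<in>UNIV. ?f a b)" by (rule sum.cartesian_product[symmetric])
    finally show ?thesis unfolding alternation_hform_expand by (simp add: mult_ac)
  qed
  moreover have "?C \<noteq> 0" using c w by simp
  ultimately show ?thesis by blast
qed

section \<open>The complex Hessian\<close>

text \<open>
  The mean value theorem is applied to \<open>s \<mapsto> f (z + s u + t w) - f (z + s u)\<close> on the interval from 0
  to \<open>t\<close>. Both values of the first derivative that occur are replaced by their linear
  approximations at \<open>z\<close>, whose difference is \<open>t * B w u\<close>.
\<close>

lemma second_difference_estimate: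
  fixes f :: "'a::real_normed_vector \<Rightarrow> real" and B :: "'a \<Rightarrow> 'a \<Rightarrow> real"
  assumes S: "open S" "z \<in> S"
    and f': "\<And>x. x \<in> S \<Longrightarrow> (f has_derivative f' x) (at x)"
    and f2: "((\<lambda>x. f' x u) has_derivative (\<lambda>h. B h u)) (at z)"
    and "\<epsilon> > 0"
  shows "\<exists>\<delta>>0. \<forall>t. 0 < t \<and> t < \<delta> \<longrightarrow>
    \<bar>f (z + t *\<^sub>R u + t *\<^sub>R w) - f (z + t *\<^sub>R u) - f (z + t *\<^sub>R w) + f z - t\<^sup>2 * B w u\<bar> \<le> \<epsilon> * t\<^sup>2"
proof -
  define K where "K = norm u + norm w + 1"
  have K: "K > 0" unfolding K_def by (smt (verit) norm_ge_zero)
  interpret lin: bounded_linear "\<lambda>h. B h u" using f2 by (rule has_derivative_bounded_linear)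
  obtain d where d: "d > 0" and approx: "\<And>y. norm (y - z) < d \<Longrightarrow>
      \<bar>f' y u - f' z u - B (y - z) u\<bar> \<le> \<epsilon> / (2 * K) * norm (y - z)"
    using f2 \<open>\<epsilon> > 0\<close> K unfolding has_derivative_at_alt real_norm_def
    by (metis divide_pos_pos mult_pos_pos zero_less_numeral)
  obtain r where r: "r > 0" "ball z r \<subseteq> S" using S open_contains_ball by blast
  define \<delta> where "\<delta> = min d r / K"
  have "\<delta> > 0" using d r K by (simp add: \<delta>_def)
  moreover have "\<bar>f (z + t *\<^sub>R u + t *\<^sub>R w) - f (z + t *\<^sub>R u) - f (z + t *\<^sub>R w) + f z - t\<^sup>2 * B w u\<bar> \<le> \<epsilon> * t\<^sup>2"
    if t: "0 < t" "t < \<delta>" for t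
  proof -
    have tK: "t * K < d" "t * K < r" using t K by (simp_all add: \<delta>_def field_simps)
    have near: "norm (s *\<^sub>R u + c *\<^sub>R w) \<le> t * K" if "0 \<le> s" "s \<le> t" "0 \<le> c" "c \<le> t" for s c
    proof -
      have "norm (s *\<^sub>R u + c *\<^sub>R w) \<le> s * norm u + c * norm w"
        using norm_triangle_ineq[of "s *\<^sub>R u" "c *\<^sub>R w"] that by simp
      also have "\<dots> \<le> t * norm u + t * norm w"
        using that by (intro add_mono mult_right_mono) auto
      also have "\<dots> \<le> t * K" using t by (simp add: K_def algebra_simps)
      finally show ?thesis .
    qed
    have inS: "z + s *\<^sub>R u + c *\<^sub>R w \<in> S" if "0 \<le> s" "s \<le> t" "0 \<le> c" "c \<le> t" for s c
    proof -
      have "dist z (z + s *\<^sub>R u + c *\<^sub>R w) = norm (s *\<^sub>R u + c *\<^sub>R w)"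
        by (metis add.assoc add_diff_cancel_left' dist_commute dist_norm)
      then show ?thesis using near[OF that] tK r by auto
    qed
    define \<phi> where "\<phi> = (\<lambda>s. f (z + s *\<^sub>R u + t *\<^sub>R w) - f (z + s *\<^sub>R u + 0 *\<^sub>R w))"
    have der: "(\<phi> has_derivative (\<lambda>h. h * (f' (z + s *\<^sub>R u + t *\<^sub>R w) u - f' (z + s *\<^sub>R u + 0 *\<^sub>R w) u))) (at s)"
      if "0 \<le> s" "s \<le> t" for s
    proof -
      have *: "((\<lambda>s. f (z + s *\<^sub>R u + c *\<^sub>R w)) has_derivative (\<lambda>h. h * f' (z + s *\<^sub>R u + c *\<^sub>R w) u)) (at s)"
        if "0 \<le> c" "c \<le> t" for c
      proof -
        have F: "(f has_derivative f' (z + s *\<^sub>R u + c *\<^sub>R w)) (at (z + s *\<^sub>R u + c *\<^sub>R w))"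
          using f' inS \<open>0 \<le> s\<close> \<open>s \<le> t\<close> that by blast
        interpret F: bounded_linear "f' (z + s *\<^sub>R u + c *\<^sub>R w)"
          using F by (rule has_derivative_bounded_linear)
        have "((\<lambda>s. z + s *\<^sub>R u + c *\<^sub>R w) has_derivative (\<lambda>h. h *\<^sub>R u)) (at s)"
          by (auto intro!: derivative_eq_intros)
        from has_derivative_compose[OF this F]
        show ?thesis by (simp add: F.scaleR)
      qed
      show ?thesis unfolding \<phi>_def
        using has_derivative_diff[OF *[of t] *[of 0]] t by (simp add: algebra_simps)
    qed
    obtain \<xi> where \<xi>: "\<xi> \<in> {0<..<t}" and mvt:
      "\<phi> t - \<phi> 0 = (t - 0) * (f' (z + \<xi> *\<^sub>R u + t *\<^sub>R w) u - f' (z + \<xi> *\<^sub>R u + 0 *\<^sub>R w) u)"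
      using mvt_simple[of 0 t \<phi> "\<lambda>s h. h * (f' (z + s *\<^sub>R u + t *\<^sub>R w) u - f' (z + s *\<^sub>R u + 0 *\<^sub>R w) u)"]
        t der by (metis atLeastAtMost_iff has_derivative_at_withinI)
    have est: "\<bar>f' (z + \<xi> *\<^sub>R u + c *\<^sub>R w) u - f' z u - B (\<xi> *\<^sub>R u + c *\<^sub>R w) u\<bar> \<le> \<epsilon> / 2 * t"
      if "0 \<le> c" "c \<le> t" for c
    proof -
      have n: "norm (\<xi> *\<^sub>R u + c *\<^sub>R w) \<le> t * K" using near[of \<xi> c] \<xi> that by auto
      have "\<bar>f' (z + \<xi> *\<^sub>R u + c *\<^sub>R w) u - f' z u - B (\<xi> *\<^sub>R u + c *\<^sub>R w) u\<bar>
          \<le> \<epsilon> / (2 * K) * norm (\<xi> *\<^sub>R u + c *\<^sub>R w)"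
        using approx[of "z + \<xi> *\<^sub>R u + c *\<^sub>R w"] n tK by (simp add: add.assoc)
      also have "\<dots> \<le> \<epsilon> / (2 * K) * (t * K)"
        using n \<open>\<epsilon> > 0\<close> K by (intro mult_left_mono) auto
      also have "\<dots> = \<epsilon> / 2 * t" using K by simp
      finally show ?thesis .
    qed
    have lin_eq: "B (\<xi> *\<^sub>R u + t *\<^sub>R w) u - B (\<xi> *\<^sub>R u + 0 *\<^sub>R w) u = t * B w u"
      by (simp add: lin.add lin.scaleR lin.zero)
    have "\<bar>f' (z + \<xi> *\<^sub>R u + t *\<^sub>R w) u - f' (z + \<xi> *\<^sub>R u + 0 *\<^sub>R w) u - t * B w u\<bar> \<le> \<epsilon> * t"
      using est[of t] est[of 0] t lin_eq by (simp only: abs_le_iff) (simp; linarith)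
    then have "\<bar>t * (f' (z + \<xi> *\<^sub>R u + t *\<^sub>R w) u - f' (z + \<xi> *\<^sub>R u + 0 *\<^sub>R w) u - t * B w u)\<bar> \<le> t * (\<epsilon> * t)"
      using t by (simp add: abs_mult)
    moreover have "f (z + t *\<^sub>R u + t *\<^sub>R w) - f (z + t *\<^sub>R u) - f (z + t *\<^sub>R w) + f z = \<phi> t - \<phi> 0"
      by (simp add: \<phi>_def)
    ultimately show ?thesis using mvt
      by (simp add: power2_eq_square algebra_simps)
  qed
  ultimately show ?thesis by blast
qed

text \<open>
  The second difference is symmetric in \<open>u\<close> and \<open>w\<close>, and after division by \<open>t\<^sup>2\<close> it converges both to
  \<open>B w u\<close> and to \<open>B u w\<close>.
\<close>

lemma second_derivative_symmetric:
  fixes f :: "'a::real_normed_vector \<Rightarrow> real" and B :: "'a \<Rightarrow> 'a \<Rightarrow> real"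
  assumes S: "open S" "z \<in> S"
    and f': "\<And>x. x \<in> S \<Longrightarrow> (f has_derivative f' x) (at x)"
    and f2: "\<And>e. ((\<lambda>x. f' x e) has_derivative (\<lambda>h. B h e)) (at z)"
  shows "B u w = B w u"
proof -
  have "\<bar>B u w - B w u\<bar> \<le> e" if "e > 0" for e
  proof -
    have e: "e / 2 > 0" using that by simp
    obtain d1 where d1: "d1 > 0" "\<And>t. 0 < t \<Longrightarrow> t < d1 \<Longrightarrow>
      \<bar>f (z + t *\<^sub>R u + t *\<^sub>R w) - f (z + t *\<^sub>R u) - f (z + t *\<^sub>R w) + f z - t\<^sup>2 * B w u\<bar> \<le> e / 2 * t\<^sup>2"
      using second_difference_estimate[where f'=f' and B=B and u=u and w=w, OF S f' f2 e] by blast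
    obtain d2 where d2: "d2 > 0" "\<And>t. 0 < t \<Longrightarrow> t < d2 \<Longrightarrow>
      \<bar>f (z + t *\<^sub>R w + t *\<^sub>R u) - f (z + t *\<^sub>R w) - f (z + t *\<^sub>R u) + f z - t\<^sup>2 * B u w\<bar> \<le> e / 2 * t\<^sup>2"
      using second_difference_estimate[where f'=f' and B=B and u=w and w=u, OF S f' f2 e] by blast
    define t where "t = min d1 d2 / 2"
    have t: "0 < t" "t < d1" "t < d2" using d1(1) d2(1) by (auto simp: t_def)
    have "z + t *\<^sub>R w + t *\<^sub>R u = z + t *\<^sub>R u + t *\<^sub>R w" by simp
    then have "\<bar>t\<^sup>2 * B u w - t\<^sup>2 * B w u\<bar> \<le> e * t\<^sup>2"
      using d1(2)[OF t(1,2)] d2(2)[OF t(1,3)] by (simp only:)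
    then have "t\<^sup>2 * \<bar>B u w - B w u\<bar> \<le> t\<^sup>2 * e"
      by (simp only: right_diff_distrib[symmetric] abs_mult) (simp add: mult.commute)
    then show ?thesis using t by simp
  qed
  then have "\<bar>B u w - B w u\<bar> \<le> 0" by (rule field_le_epsilon) simp
  then show ?thesis by simp
qed

lemma dir_deriv_has_derivative:
  assumes "(g has_derivative g') (at z)"
  shows "dir_deriv g e z = g' e"
proof -
  interpret bounded_linear g' using assms by (rule has_derivative_bounded_linear)
  have 1: "((\<lambda>t::real. z + t *\<^sub>R e) has_derivative (\<lambda>h. h *\<^sub>R e)) (at 0)"
    by (auto intro!: derivative_eq_intros)
  have 2: "(g has_derivative g') (at (z + 0 *\<^sub>R e))" using assms by simp
  have "((\<lambda>t. g (z + t *\<^sub>R e)) has_vector_derivative g' e) (at 0)"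
    using has_derivative_compose[OF 1 2] by (simp add: has_vector_derivative_def scaleR)
  then show ?thesis unfolding dir_deriv_def by (rule vector_derivative_at)
qed

lemma wirtinger_wirtinger_bar:
  fixes f :: "complex^'n \<Rightarrow> real" and B :: "complex^'n \<Rightarrow> complex^'n \<Rightarrow> real"
  assumes S: "open S" "z \<in> S"
    and f': "\<And>x. x \<in> S \<Longrightarrow> (f has_derivative f' x) (at x)"
    and f2: "\<And>e. ((\<lambda>x. f' x e) has_derivative (\<lambda>h. B h e)) (at z)"
  shows "wirtinger k (wirtinger_bar l (\<lambda>x. complex_of_real (f x))) z =
    (B (axis k 1) (axis l 1) + B (axis k \<i>) (axis l \<i>)
      + \<i> * (B (axis k 1) (axis l \<i>) - B (axis k \<i>) (axis l 1))) / 4"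
proof -
  define g where "g = wirtinger_bar l (\<lambda>x. complex_of_real (f x))"
  define h where "h = (\<lambda>x. (complex_of_real (f' x (axis l 1)) + \<i> * complex_of_real (f' x (axis l \<i>))) / 2)"
  have gh: "g x = h x" if "x \<in> S" for x
  proof -
    have "((\<lambda>x. complex_of_real (f x)) has_derivative (\<lambda>e. complex_of_real (f' x e))) (at x)"
      using f'[OF that] by (rule has_derivative_of_real)
    from dir_deriv_has_derivative[OF this] show ?thesis
      by (simp add: g_def h_def wirtinger_bar_def)
  qed
  have "(h has_derivative (\<lambda>e. (complex_of_real (B e (axis l 1)) + \<i> * complex_of_real (B e (axis l \<i>))) / 2)) (at z)"
    unfolding h_def divide_inverse
    by (intro has_derivative_mult_left has_derivative_add has_derivative_mult_right has_derivative_of_real f2)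
  then have "(g has_derivative (\<lambda>e. (complex_of_real (B e (axis l 1)) + \<i> * complex_of_real (B e (axis l \<i>))) / 2)) (at z)"
    using S by (rule has_derivative_transform_within_open) (simp add: gh)
  note dir = dir_deriv_has_derivative[OF this]
  show ?thesis
    unfolding g_def[symmetric] wirtinger_def dir by (simp add: complex_eq_iff field_simps)
qed

text \<open>
  In real terms the entries are combinations of values of the second derivative at the vectors \<open>e\<close> and
  \<open>\<i> e\<close>. Interchanging \<open>k\<close> and \<open>l\<close> leaves the real part alone and flips the sign of the
  imaginary part, by the symmetry of the second derivative.
\<close>

lemma levi_hermitian:
  fixes f :: "complex^'n \<Rightarrow> real"
  assumes S: "open S" "z \<in> S" and "C2_on f S"
  shows "wirtinger l (wirtinger_bar k (\<lambda>x. complex_of_real (f x))) z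
    = cnj (wirtinger k (wirtinger_bar l (\<lambda>x. complex_of_real (f x))) z)"
proof -
  obtain f' :: "complex^'n \<Rightarrow> (complex^'n) \<Rightarrow>\<^sub>L real" and f'' :: "complex^'n \<Rightarrow> (complex^'n) \<Rightarrow>\<^sub>L (complex^'n) \<Rightarrow>\<^sub>L real"
    where 1: "\<And>x. x \<in> S \<Longrightarrow> (f has_derivative blinfun_apply (f' x)) (at x)"
      and 2: "\<And>x. x \<in> S \<Longrightarrow> (f' has_derivative blinfun_apply (f'' x)) (at x)"
    using assms(3) unfolding C2_on_def by blast
  have 3: "((\<lambda>x. blinfun_apply (f' x) e) has_derivative (\<lambda>h. blinfun_apply (blinfun_apply (f'' z) h) e)) (at z)" for e
    using bounded_linear.has_derivative[OF blinfun.bounded_linear_left 2[OF S(2)]]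
    by (simp add: o_def)
  note sym = second_derivative_symmetric[OF S 1 3]
  show ?thesis
    using wirtinger_wirtinger_bar[OF S 1 3, of k l] wirtinger_wirtinger_bar[OF S 1 3, of l k]
      sym[of "axis l 1" "axis k 1"] sym[of "axis l 1" "axis k \<i>"]
      sym[of "axis l \<i>" "axis k 1"] sym[of "axis l \<i>" "axis k \<i>"]
    by (simp add: complex_eq_iff)
qed

text \<open>
  The second derivative of the squared norm is twice the inner product. For \<open>k = l\<close> the real part is
  \<open>(2 + 2) / 4 = 1\<close>, and the imaginary part vanishes because \<open>e\<close> is orthogonal to \<open>\<i> e\<close>.
\<close>

lemma wirtinger_norm_squared:
  "wirtinger k (wirtinger_bar l (\<lambda>x :: complex^'n. complex_of_real ((norm x)\<^sup>2))) z = (if k = l then 1 else 0)"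
proof -
  have 1: "((\<lambda>x :: complex^'n. (norm x)\<^sup>2) has_derivative (\<lambda>h. 2 * (x \<bullet> h))) (at x)" for x :: "complex^'n"
    unfolding power2_norm_eq_inner
    by (auto intro!: derivative_eq_intros simp: inner_commute)
  have 2: "((\<lambda>x :: complex^'n. 2 * (x \<bullet> e)) has_derivative (\<lambda>h. 2 * (h \<bullet> e))) (at z)" for e :: "complex^'n"
    by (auto intro!: derivative_eq_intros)
  show ?thesis
    unfolding wirtinger_wirtinger_bar[OF open_UNIV UNIV_I 1 2]
    by (auto simp: inner_axis_axis)
qed

section \<open>The theorem\<close>

lemma ddc_eq_hform:
  "ddc v z = alternation 2 (\<lambda>u. hform
    (\<lambda>k l. wirtinger k (wirtinger_bar l (\<lambda>x. complex_of_real (v x))) z) (u 0) (u 1))"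
proof
  fix w
  define H where "H k l = wirtinger k (wirtinger_bar l (\<lambda>x. complex_of_real (v x))) z" for k l
  have "ddc v z w = \<i> / 2 * (\<Sum>k\<in>UNIV. \<Sum>l\<in>UNIV.
      H k l * alternation 2 (\<lambda>u. u 0 $ k * cnj (u 1 $ l)) w)"
    by (simp add: ddc_def H_def wedge_eq_alternation dz_def dzbar_def numeral_2_eq_2)
  also have "\<dots> = (\<Sum>(k, l)\<in>UNIV \<times> UNIV. (\<i> / 2 * H k l) * alternation 2 (\<lambda>u. u 0 $ k * cnj (u 1 $ l)) w)"
    by (simp only: sum.cartesian_product sum_distrib_left case_prod_unfold mult.assoc)
  also have "\<dots> = alternation 2 (\<lambda>u. \<Sum>(k, l)\<in>UNIV \<times> UNIV. (\<i> / 2 * H k l) * (u 0 $ k * cnj (u 1 $ l))) w"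
    by (simp only: case_prod_unfold) (rule alternation_sum[symmetric])
  also have "\<dots> = alternation 2 (\<lambda>u. hform H (u 0) (u 1)) w"
    by (simp only: hform_def sum.cartesian_product[symmetric] sum_distrib_left mult.assoc)
  finally show "ddc v z w = alternation 2 (\<lambda>u. hform
    (\<lambda>k l. wirtinger k (wirtinger_bar l (\<lambda>x. complex_of_real (v x))) z) (u 0) (u 1)) w"
    by (simp only: H_def[abs_def])
qed

lemma kaehler_form_eq_hform:
  "kaehler_form z = alternation 2 (\<lambda>u. hform (\<lambda>k l. if k = l then 1 else 0) (u 0) (u 1))"
  unfolding kaehler_form_def ddc_eq_hform wirtinger_norm_squared ..

text \<open>
  The double sum is the square of the trace minus the trace of \<open>H * H\<close>, and for a Hermitian matrix the
  latter is the sum of the squared absolute values of all entries.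
\<close>

lemma hermitian_eq_0:
  fixes H :: "'n::finite \<Rightarrow> 'n \<Rightarrow> complex"
  assumes herm: "\<And>k l. H l k = cnj (H k l)"
    and tr: "(\<Sum>a\<in>UNIV. H a a) = 0"
    and minors: "(\<Sum>a\<in>UNIV. \<Sum>b\<in>UNIV. H a a * H b b - H a b * H b a) = 0"
  shows "H k l = 0"
proof -
  have "(\<Sum>a\<in>UNIV. \<Sum>b\<in>UNIV. H a a * H b b) = (\<Sum>a\<in>UNIV. H a a) * (\<Sum>b\<in>UNIV. H b b)"
    by (simp add: sum_product)
  then have "(\<Sum>a\<in>UNIV. \<Sum>b\<in>UNIV. H a b * H b a) = 0"
    using minors tr by (simp add: sum_subtractf)
  moreover have "H a b * H b a = complex_of_real ((cmod (H a b))\<^sup>2)" for a b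
    using herm[of b a] by (simp only: complex_norm_square)
  ultimately have "(\<Sum>a\<in>UNIV. \<Sum>b\<in>UNIV. (cmod (H a b))\<^sup>2) = 0"
    by (simp only: of_real_sum[symmetric] of_real_eq_0_iff)
  then have "(\<Sum>b\<in>UNIV. (cmod (H k b))\<^sup>2) = 0"
    by (subst (asm) sum_nonneg_eq_0_iff) (auto intro: sum_nonneg)
  then show ?thesis
    by (subst (asm) sum_nonneg_eq_0_iff) auto
qed

text \<open>
  The mixed discriminant is used twice, with the same constant and test vectors: with one copy of \<open>H\<close>
  and the identity it gives \<open>(n - 1)\<close> times the trace of \<open>H\<close>, with two copies of \<open>H\<close> it gives the sum of
  the principal minors.
\<close>

lemma levi_zero_of_wedges:
  fixes H :: "'n::finite \<Rightarrow> 'n \<Rightarrow> complex"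
  assumes n: "CARD('n) \<ge> 2"
    and herm: "\<And>k l. H l k = cnj (H k l)"
    and \<alpha>: "\<alpha> = alternation 2 (\<lambda>u. hform H (u 0) (u 1))"
    and \<omega>: "\<omega> = alternation 2 (\<lambda>u. hform (\<lambda>k l. if k = l then 1 else 0) (u 0) (u 1))"
    and wedges: "\<And>k w. k \<in> {1..2} \<Longrightarrow>
      wedge (2 * k) (2 * (CARD('n) - k)) (wedge_power \<alpha> k) (wedge_power \<omega> (CARD('n) - k)) w = 0"
  shows "H k l = 0"
proof -
  define \<delta> :: "'n \<Rightarrow> 'n \<Rightarrow> complex" where "\<delta> = (\<lambda>k l. if k = l then 1 else 0)"
  obtain C w where C: "C \<noteq> 0" and disc: "\<And>M :: nat \<Rightarrow> 'n \<Rightarrow> 'n \<Rightarrow> complex. \<forall>i\<ge>2. M i = \<delta> \<Longrightarrow>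
      alternation (2 * CARD('n)) (\<lambda>u. \<Prod>i<CARD('n). hform (M i) (u (2 * i)) (u (2 * i + 1))) w
        = C * (\<Sum>a\<in>UNIV. \<Sum>b\<in>UNIV. M 0 a a * M 1 b b - M 0 a b * M 1 b a)"
    using mixed_discriminant[OF refl n] unfolding \<delta>_def by blast
  have zero: "(\<Sum>a\<in>UNIV. \<Sum>b\<in>UNIV. H a a * (if 1 < k then H else \<delta>) b b
      - H a b * (if 1 < k then H else \<delta>) b a) = 0" if k: "k \<in> {1..2}" for k :: nat
  proof -
    define M where "M i = (if i < k then H else \<delta>)" for i
    have "(\<lambda>u. \<Prod>i<CARD('n). (if i < k then hform H else hform \<delta>) (u (2 * i)) (u (2 * i + 1)))
        = (\<lambda>u. \<Prod>i<CARD('n). hform (M i) (u (2 * i)) (u (2 * i + 1)))"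
      by (simp add: M_def if_distrib)
    moreover have "k + (CARD('n) - k) = CARD('n)" using k n by auto
    ultimately have "alternation (2 * CARD('n))
        (\<lambda>u. \<Prod>i<CARD('n). hform (M i) (u (2 * i)) (u (2 * i + 1))) w = 0"
      using wedges[OF k, of w] wedge_wedge_power_alternation[of k "CARD('n) - k" "hform H" "hform \<delta>"]
      unfolding \<alpha> \<omega> \<delta>_def[symmetric] by simp
    moreover have "\<forall>i\<ge>2. M i = \<delta>" "M 0 = H" "M 1 = (if 1 < k then H else \<delta>)"
      using k by (auto simp: M_def)
    ultimately show ?thesis using disc[of M] C by simp
  qed
  have "(\<Sum>b\<in>UNIV. H a a * \<delta> b b) = of_nat (CARD('n)) * H a a"
    "(\<Sum>b\<in>UNIV. H a b * \<delta> b a) = H a a" for a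
    by (simp_all add: \<delta>_def if_distrib[of "\<lambda>x. _ * x"] cong: if_cong)
  then have "(\<Sum>a\<in>UNIV. \<Sum>b\<in>UNIV. H a a * \<delta> b b - H a b * \<delta> b a) = (\<Sum>a\<in>UNIV. of_nat (CARD('n)) * H a a - H a a)"
    by (simp only: sum_subtractf)
  also have "\<dots> = of_nat (CARD('n) - 1) * (\<Sum>a\<in>UNIV. H a a)"
    using n by (simp add: of_nat_diff algebra_simps sum_subtractf sum_distrib_left)
  finally have "(\<Sum>a\<in>UNIV. H a a) = 0" using zero[of 1] n by simp
  moreover have "(\<Sum>a\<in>UNIV. \<Sum>b\<in>UNIV. H a a * H b b - H a b * H b a) = 0" using zero[of 2] by simp
  ultimately show ?thesis using hermitian_eq_0[of H, OF herm] by blast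
qed

theorem theorem3p2:
  fixes \<Omega> :: "(complex^'n) set" and v :: "complex^'n \<Rightarrow> real"
  assumes "CARD('n) \<ge> 2"
    and "open \<Omega>" and "connected \<Omega>" and "\<Omega> \<noteq> {}"
    and "C2_on v \<Omega>"
  shows "m_harmonic_on 2 v \<Omega> \<longleftrightarrow> pluriharmonic_on v \<Omega>"
proof
  assume harmonic: "m_harmonic_on 2 v \<Omega>"
  show "pluriharmonic_on v \<Omega>"
    unfolding pluriharmonic_on_def
  proof (intro ballI allI)
    fix z w assume z: "z \<in> \<Omega>"
    have "wirtinger k (wirtinger_bar l (\<lambda>x. complex_of_real (v x))) z = 0" for k l
    proof (rule levi_zero_of_wedges[OF assms(1) _ ddc_eq_hform kaehler_form_eq_hform])
      fix k l
      show "wirtinger l (wirtinger_bar k (\<lambda>x. complex_of_real (v x))) z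
          = cnj (wirtinger k (wirtinger_bar l (\<lambda>x. complex_of_real (v x))) z)"
        by (rule levi_hermitian[OF assms(2) z assms(5)])
    next
      fix k :: nat and w assume "k \<in> {1..2}"
      then show "wedge (2 * k) (2 * (CARD('n) - k)) (wedge_power (ddc v z) k)
          (wedge_power (kaehler_form z) (CARD('n) - k)) w = 0"
        using harmonic z unfolding m_harmonic_on_def by blast
    qed
    then show "ddc v z w = 0" by (simp add: ddc_def)
  qed
next
  assume "pluriharmonic_on v \<Omega>"
  then have zero: "ddc v z = (\<lambda>w. 0)" if "z \<in> \<Omega>" for z
    using that by (auto simp: pluriharmonic_on_def)
  show "m_harmonic_on 2 v \<Omega>"
    unfolding m_harmonic_on_def
  proof (intro ballI allI)
    fix k :: nat and z w assume "k \<in> {1..2}" "z \<in> \<Omega>"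
    then obtain j where "k = Suc j" by (cases k) auto
    then have "wedge_power (ddc v z) k = (\<lambda>w. 0)"
      using zero[OF \<open>z \<in> \<Omega>\<close>] by (simp add: wedge_def fun_eq_iff)
    then show "wedge (2 * k) (2 * (CARD('n) - k)) (wedge_power (ddc v z) k)
        (wedge_power (kaehler_form z) (CARD('n) - k)) w = 0"
      by (simp add: wedge_def)
  qed
qed

end
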